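(* Let $n\in\mathbb{N}$, let $\omega=e^{2\pi \mathrm{i}/n}$, and let $f$ be an entire function. For $f$ to preserve nonnegativity of circulant matrices of order $n$ (i.e., for $f(A)$ to be entrywise nonnegative for every entrywise nonnegative circulant $A\in\mathbb{R}^{n\times n}$), it is necessary and sufficient that for every $l=0,\ldots,n-1$, $$\sum_{k=0}^{n-1}\omega^{-lk}\, f\Bigl(\sum_{j=0}^{n-1}\omega^{jk}a_j\Bigr)\ge 0\qquad\text{whenever } a_j\ge 0,\ j=0,\ldots,n-1.$$
   Context: A circulant matrix of order $n$ with first row $(a_0,\ldots,a_{n-1})$ is the matrix whose $(p,q)$ entry, for $0\le p,q\le n-1$, is $a_{(q-p)\bmod n}$. For an entire $f(z)=\sum_{j\ge0}c_jz^j$, $f(A)=\sum_{j\ge0}c_jA^j$ is the usual (primary) matrix function. The inequality "$\ge 0$" for a complex-valued expression means that it is real and nonnegative. *)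

theory Defs
  imports "HOL-Complex_Analysis.Complex_Analysis" "Jordan_Normal_Form.Jordan_Normal_Form"
begin

definition circulant :: "nat \<Rightarrow> (nat \<Rightarrow> 'a) \<Rightarrow> 'a mat" where
  "circulant n a = mat n n (\<lambda>(p, q). a (nat ((int q - int p) mod int n)))"

definition is_circulant :: "nat \<Rightarrow> 'a mat \<Rightarrow> bool" where
  "is_circulant n A \<longleftrightarrow> (\<exists>a. A = circulant n a)"

(* The coefficients are those of the power series of f about 0. For entire f and square A
   the entrywise series converges, see summable_entire_mat_fun below. *)
definition entire_mat_fun :: "(complex \<Rightarrow> complex) \<Rightarrow> complex mat \<Rightarrow> complex mat" where
  "entire_mat_fun f A = mat (dim_row A) (dim_row A)
     (\<lambda>(p, q). \<Sum>j. (deriv ^^ j) f 0 / fact j * (A ^\<^sub>m j) $$ (p, q))"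

definition preserves_nonneg_circulants :: "nat \<Rightarrow> (complex \<Rightarrow> complex) \<Rightarrow> bool" where
  "preserves_nonneg_circulants n f \<longleftrightarrow>
     (\<forall>A :: real mat. is_circulant n A \<longrightarrow> (\<forall>p<n. \<forall>q<n. A $$ (p, q) \<ge> 0) \<longrightarrow>
        (\<forall>p<n. \<forall>q<n.
           entire_mat_fun f (map_mat complex_of_real A) $$ (p, q) \<in> \<real>\<^sub>\<ge>\<^sub>0))"

lemma entire_taylor_sums:
  assumes "f holomorphic_on UNIV"
  shows "(\<lambda>j. (deriv ^^ j) f 0 / fact j * z ^ j) sums f z"
proof -
  have "f holomorphic_on ball 0 (norm z + 1)"
    using assms by (rule holomorphic_on_subset) simp
  from holomorphic_power_series[OF this, of z] show ?thesis by simp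
qed

lemma summable_entire_mat_fun:
  assumes f: "f holomorphic_on UNIV" and A: "A \<in> carrier_mat n n"
    and p: "p < n" and q: "q < n"
  shows "summable (\<lambda>j. (deriv ^^ j) f 0 / fact j * (A ^\<^sub>m j) $$ (p, q))"
proof -
  define M where "M = Max {norm (A $$ (i,j)) | i j. i < dim_row A \<and> j < dim_col A}"
  have M: "norm_bound A M"
    unfolding M_def by (rule norm_bound_max)
  have "norm (A $$ (p, q)) \<le> M"
    using M A p q by (auto simp: norm_bound_def)
  then have M0: "M \<ge> 0"
    by (meson norm_ge_zero order_trans)
  define b where "b = real n * M"
  have b0: "b \<ge> 0"
    using M0 by (simp add: b_def)
  have pow: "norm_bound (A ^\<^sub>m j) (b ^ j)" for j
  proof (induction j)
    case 0
    then show ?case by (auto simp: norm_bound_def one_mat_def)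
  next
    case (Suc j)
    have "A ^\<^sub>m j \<in> carrier_mat n n"
      using A by (rule pow_carrier_mat)
    from norm_bound_mult[OF this A Suc M] show ?case
      by (simp add: b_def mult_ac)
  qed
  have "summable (\<lambda>j. (deriv ^^ j) f 0 / fact j * of_real (b + 1) ^ j)"
    using entire_taylor_sums[OF f] by (rule sums_summable)
  then have s: "summable (\<lambda>j. norm ((deriv ^^ j) f 0 / fact j * of_real b ^ j))"
    by (rule powser_insidea) (use b0 in \<open>simp only: norm_of_real; simp\<close>)
  have le: "norm ((A ^\<^sub>m j) $$ (p, q)) \<le> b ^ j" for j
    using pow[of j] pow_carrier_mat[OF A, of j] p q
    unfolding norm_bound_def by (metis carrier_matD)
  show ?thesis
  proof (rule summable_comparison_test'[OF s, of 0])
    fix j :: nat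
    show "norm ((deriv ^^ j) f 0 / fact j * (A ^\<^sub>m j) $$ (p, q))
        \<le> norm ((deriv ^^ j) f 0 / fact j * of_real b ^ j)"
      using le[of j] b0 by (simp only: norm_mult norm_power norm_of_real abs_of_nonneg)
        (intro mult_left_mono, auto)
  qed
qed

end

theory Submission
  imports Defs
begin

text \<open>
  The vectors $v_k = (\omega^{qk})_q$ form a common orthogonal eigenbasis of all circulant matrices:
  a circulant $A$ with first row $a$ has eigenvalue $\lambda_k = \sum_j \omega^{jk} a_j$ at $v_k$.
  Hence the $(p,q)$ entry of $f(A)$ is $\frac1n \sum_k \omega^{(p-q)k} f(\lambda_k)$, which depends
  on $l = (q-p) \bmod n$ only and is $\frac1n$ times the sum in the criterion.
\<close>

text \<open>The kernel of \<open>exp\<close> is 2 \<pi> \<i> times the integers, so the exponent 2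
  \<pi> \<i> i / n lies in it exactly when i / n is an integer.\<close>

lemma root_unity_powi_eq_1_iff:
  fixes n :: nat and i :: int
  assumes n: "n \<ge> 1"
  shows "exp (2 * of_real pi * \<i> / of_nat n) powi i = 1 \<longleftrightarrow> int n dvd i"
proof -
  have "exp (2 * of_real pi * \<i> / of_nat n) powi i = exp (of_int i * (2 * of_real pi * \<i> / of_nat n))"
    by (metis exp_power_int mult.commute)
  also have "\<dots> = 1 \<longleftrightarrow> (\<exists>m::int. real_of_int i * (2 * pi) / real n = real_of_int (2 * m) * pi)"
    by (simp add: exp_eq_1)
  also have "\<dots> \<longleftrightarrow> (\<exists>m::int. real_of_int i = real_of_int (int n * m))"
    using n by (intro ex_cong1) (auto simp: field_simps)
  also have "\<dots> \<longleftrightarrow> int n dvd i"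
    by (simp only: of_int_eq_iff dvd_def)
  finally show ?thesis .
qed

text \<open>Everything below rests on \<omega> having exact order \<open>n\<close>. This is stated
  for integer exponents because differences of matrix indices will occur as exponents.\<close>

locale primitive_root_unity =
  fixes n :: nat and \<omega> :: complex
  assumes n_pos: "n \<ge> 1"
    and powi_eq_1_iff: "\<omega> powi i = 1 \<longleftrightarrow> int n dvd i"
begin

lemma nonzero: "\<omega> \<noteq> 0"
  using powi_eq_1_iff[of "int n"] n_pos by (auto simp: power_0_left)

text \<open>The two exponents differ by a multiple of \<open>n\<close>, whose power of \<omega> is
  1. This removes the \<open>mod\<close> that the indices of a circulant carry.\<close>

lemma powi_mod_mult: "\<omega> powi ((i mod int n) * j) = \<omega> powi (i * j)"
proof -
  have "\<omega> powi (i * j) = \<omega> powi (int n * ((i div int n) * j) + (i mod int n) * j)"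
    by (metis distrib_right mult.assoc mult_div_mod_eq)
  also have "\<dots> = \<omega> powi (int n * ((i div int n) * j)) * \<omega> powi ((i mod int n) * j)"
    using nonzero by (simp add: power_int_add)
  also have "\<omega> powi (int n * ((i div int n) * j)) = 1"
    by (simp add: powi_eq_1_iff)
  finally show ?thesis by simp
qed

text \<open>Off the diagonal this is a geometric sum whose ratio \<open>z\<close> satisfies
  \<open>z ^ n = 1\<close> and \<open>z \<noteq> 1\<close>.\<close>

lemma sum_powi_orthogonal:
  assumes "p < n" "q < n"
  shows "(\<Sum>k<n. \<omega> powi ((int p - int q) * int k)) = (if p = q then of_nat n else 0)"
proof (cases "p = q")
  case False
  define z where "z = \<omega> powi (int p - int q)"
  \<comment> \<open>The difference is nonzero and smaller than \<open>n\<close> in absolute value;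
    the two instances cover its two possible signs.\<close>
  have "\<not> int n dvd int p - int q"
    using assms False zdvd_not_zless[of "int p - int q" "int n"] zdvd_not_zless[of "int q - int p" "int n"]
    by (auto simp: dvd_diff_commute linorder_neq_iff)
  then have "z \<noteq> 1"
    by (simp add: z_def powi_eq_1_iff)
  have "z ^ n = \<omega> powi ((int p - int q) * int n)"
    by (simp add: z_def power_int_mult)
  also have "\<dots> = 1"
    by (simp add: powi_eq_1_iff)
  finally have "(\<Sum>k<n. z ^ k) = 0"
    using \<open>z \<noteq> 1\<close> by (simp add: geometric_sum)
  then show ?thesis
    using False by (simp add: z_def power_int_mult)
qed simp

text \<open>The discrete Fourier transform of the first row, unnormalised and with positive
  exponents.\<close>

definition eigval :: "(nat \<Rightarrow> complex) \<Rightarrow> nat \<Rightarrow> complex" where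
  "eigval a k = (\<Sum>j<n. \<omega> ^ (j * k) * a j)"

text \<open>The row vector with entries \<omega>^(-rk) is a left eigenvector of the circulant:
  substituting j = (q - r) mod n turns \<omega>^(-rk) into \<omega>^(-qk) \<omega>^(jk), and the
  first factor leaves the sum.\<close>

lemma sum_circulant_column:
  assumes "q < n"
  shows "(\<Sum>r<n. \<omega> powi (- int r * int k) * a (nat ((int q - int r) mod int n)))
    = \<omega> powi (- int q * int k) * eigval a k"
proof -
  let ?\<sigma> = "\<lambda>r. nat ((int q - int r) mod int n)"
  \<comment> \<open>The reflection r \<mapsto> (q - r) mod n is an involution of the index set,
    hence its own inverse in the reindexing.\<close>
  have \<sigma>: "?\<sigma> (?\<sigma> r) = r" "?\<sigma> r \<in> {..<n}" if "r \<in> {..<n}" for r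
    using that n_pos by (auto simp: mod_simps nat_less_iff)
  have "(\<Sum>r<n. \<omega> powi (- int r * int k) * a (?\<sigma> r))
    = (\<Sum>j<n. \<omega> powi (- int q * int k) * (\<omega> ^ (j * k) * a j))"
  proof (rule sum.reindex_bij_witness[of _ ?\<sigma> ?\<sigma>, OF \<sigma>(1,2,1,2)])
    fix r
    have "\<omega> ^ (?\<sigma> r * k) = \<omega> powi (((int q - int r) mod int n) * int k)"
      using n_pos by (simp flip: power_int_of_nat)
    also have "\<dots> = \<omega> powi ((int q - int r) * int k)"
      by (rule powi_mod_mult)
    finally have "\<omega> powi (- int q * int k) * \<omega> ^ (?\<sigma> r * k)
        = \<omega> powi (- int q * int k + (int q - int r) * int k)"
      using nonzero by (simp only: power_int_add disj_not1 simp_thms)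
    also have "- int q * int k + (int q - int r) * int k = - int r * int k"
      by (simp add: algebra_simps)
    finally show "\<omega> powi (- int q * int k) * (\<omega> ^ (?\<sigma> r * k) * a (?\<sigma> r))
        = \<omega> powi (- int r * int k) * a (?\<sigma> r)"
      by (simp only: flip: mult.assoc)
  qed
  then show ?thesis
    by (simp add: eigval_def sum_distrib_left)
qed

text \<open>Spectral decomposition of the powers, by induction: orthogonality settles
  \<open>m = 0\<close>, and each further factor on the right acts on the left eigenvectors. The
  column \<open>q\<close> is generalised since the step needs the whole row \<open>p\<close> of the
  previous power.\<close>

lemma circulant_power_entry:
  assumes "p < n" "q < n"
  shows "of_nat n * (circulant n a ^\<^sub>m m) $$ (p, q)
    = (\<Sum>k<n. \<omega> powi ((int p - int q) * int k) * eigval a k ^ m)"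
  using \<open>q < n\<close>
proof (induction m arbitrary: q)
  case 0
  then show ?case
    using \<open>p < n\<close> sum_powi_orthogonal[of p q] by (simp add: circulant_def)
next
  case (Suc m)
  have C: "circulant n a \<in> carrier_mat n n"
    by (simp add: circulant_def)
  \<comment> \<open>Separating \<open>p\<close> from \<open>r\<close> exposes the left eigenvector
    in the sum over \<open>r\<close>.\<close>
  have split: "\<omega> powi ((int p - int r) * int k) = \<omega> powi (int p * int k) * \<omega> powi (- int r * int k)" for r k
  proof -
    have "(int p - int r) * int k = int p * int k + - int r * int k"
      by (simp add: algebra_simps)
    then show ?thesis
      using nonzero by (simp only: power_int_add disj_not1 simp_thms)
  qed
  have "(circulant n a ^\<^sub>m Suc m) $$ (p, q)
      = (\<Sum>r<n. (circulant n a ^\<^sub>m m) $$ (p, r) * a (nat ((int q - int r) mod int n)))"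
    using \<open>p < n\<close> \<open>q < n\<close> C pow_carrier_mat[OF C, of m]
    by (auto simp: scalar_prod_def atLeast0LessThan circulant_def intro!: sum.cong)
  then have "of_nat n * (circulant n a ^\<^sub>m Suc m) $$ (p, q)
      = (\<Sum>r<n. (\<Sum>k<n. \<omega> powi ((int p - int r) * int k) * eigval a k ^ m)
           * a (nat ((int q - int r) mod int n)))"
    by (simp add: sum_distrib_left Suc.IH mult.assoc[symmetric] del: pow_mat.simps)
  also have "\<dots> = (\<Sum>k<n. \<Sum>r<n. \<omega> powi (int p * int k) * eigval a k ^ m *
      (\<omega> powi (- int r * int k) * a (nat ((int q - int r) mod int n))))"
    unfolding sum_distrib_right split by (subst sum.swap) (simp only: mult_ac)
  also have "\<dots> = (\<Sum>k<n. \<omega> powi (int p * int k) * eigval a k ^ m *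
      (\<omega> powi (- int q * int k) * eigval a k))"
    by (simp only: sum_distrib_left[symmetric] sum_circulant_column[OF \<open>q < n\<close>])
  also have "\<dots> = (\<Sum>k<n. \<omega> powi ((int p - int q) * int k) * eigval a k ^ Suc m)"
    unfolding split by (simp only: mult_ac power_Suc)
  finally show ?case .
qed

text \<open>The Taylor series of \<open>f\<close> converges at each of the \<open>n\<close>
  eigenvalues. A finite linear combination of these series is, term by term, the series defining the
  entry.\<close>

lemma entire_mat_fun_circulant:
  assumes f: "f holomorphic_on UNIV" and "p < n" "q < n"
  shows "entire_mat_fun f (circulant n a) $$ (p, q)
    = (\<Sum>k<n. \<omega> powi ((int p - int q) * int k) * f (eigval a k)) / of_nat n"
proof -
  have "(\<lambda>j. \<Sum>k<n. \<omega> powi ((int p - int q) * int k) *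
      ((deriv ^^ j) f 0 / fact j * eigval a k ^ j)) sums
      (\<Sum>k<n. \<omega> powi ((int p - int q) * int k) * f (eigval a k))"
    by (intro sums_sum sums_mult entire_taylor_sums f)
  then have "(\<lambda>j. (\<Sum>k<n. \<omega> powi ((int p - int q) * int k) *
      ((deriv ^^ j) f 0 / fact j * eigval a k ^ j)) / of_nat n) sums
      ((\<Sum>k<n. \<omega> powi ((int p - int q) * int k) * f (eigval a k)) / of_nat n)"
    by (rule sums_divide)
  also have "(\<lambda>j. (\<Sum>k<n. \<omega> powi ((int p - int q) * int k) *
      ((deriv ^^ j) f 0 / fact j * eigval a k ^ j)) / of_nat n)
      = (\<lambda>j. (deriv ^^ j) f 0 / fact j * (circulant n a ^\<^sub>m j) $$ (p, q))"
  proof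
    fix j
    have "(circulant n a ^\<^sub>m j) $$ (p, q)
        = (\<Sum>k<n. \<omega> powi ((int p - int q) * int k) * eigval a k ^ j) / of_nat n"
      using circulant_power_entry[OF assms(2,3), of a j] n_pos by (simp add: field_simps)
    then show "(\<Sum>k<n. \<omega> powi ((int p - int q) * int k) *
        ((deriv ^^ j) f 0 / fact j * eigval a k ^ j)) / of_nat n
        = (deriv ^^ j) f 0 / fact j * (circulant n a ^\<^sub>m j) $$ (p, q)"
      by (simp add: sum_distrib_left mult_ac)
  qed
  finally show ?thesis
    using assms by (simp add: entire_mat_fun_def circulant_def sums_iff)
qed

end

lemma map_mat_circulant: "map_mat g (circulant n a) = circulant n (\<lambda>j. g (a j))"
  by (auto simp: circulant_def)

lemma circulant_index:
  assumes "p < n" "q < n"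
  shows "circulant n a $$ (p, q) = a (nat ((int q - int p) mod int n))"
  using assms by (simp add: circulant_def)

text \<open>Row 0 lists a_0, ..., a_(n-1), and every other entry is one of these values.\<close>

lemma circulant_nonneg_iff:
  fixes a :: "nat \<Rightarrow> real"
  shows "(\<forall>p<n. \<forall>q<n. circulant n a $$ (p, q) \<ge> 0) \<longleftrightarrow> (\<forall>j<n. a j \<ge> 0)"
proof
  assume *: "\<forall>p<n. \<forall>q<n. circulant n a $$ (p, q) \<ge> 0"
  show "\<forall>j<n. a j \<ge> 0"
  proof (intro allI impI)
    fix j assume "j < n"
    then show "a j \<ge> 0"
      using *[rule_format, of 0 j] by (simp add: circulant_index)
  qed
qed (auto simp: circulant_index nat_less_iff)

lemma divide_of_nat_nonneg_Reals_iff: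
  fixes z :: complex
  assumes "n \<ge> 1"
  shows "z / of_nat n \<in> \<real>\<^sub>\<ge>\<^sub>0 \<longleftrightarrow> z \<in> \<real>\<^sub>\<ge>\<^sub>0"
  using assms by (simp add: complex_nonneg_Reals_iff zero_le_divide_iff)

theorem theorem10:
  fixes n :: nat and f :: "complex \<Rightarrow> complex" and \<omega> :: complex
  assumes "n \<ge> 1"
    and "\<omega> = exp (2 * of_real pi * \<i> / of_nat n)"
    and "f holomorphic_on UNIV"
  shows "preserves_nonneg_circulants n f \<longleftrightarrow>
    (\<forall>l<n. \<forall>a :: nat \<Rightarrow> real. (\<forall>j<n. a j \<ge> 0) \<longrightarrow>
       (\<Sum>k<n. \<omega> powi (- (int l * int k)) *
          f (\<Sum>j<n. \<omega> ^ (j * k) * complex_of_real (a j))) \<in> \<real>\<^sub>\<ge>\<^sub>0)"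
proof -
  interpret primitive_root_unity n \<omega>
    using assms(1) by unfold_locales (simp_all only: assms(2) root_unity_powi_eq_1_iff)
  define S :: "nat \<Rightarrow> (nat \<Rightarrow> real) \<Rightarrow> complex" where
    "S l a = (\<Sum>k<n. \<omega> powi (- (int l * int k)) * f (eigval (\<lambda>j. of_real (a j)) k))" for l a
  \<comment> \<open>With l = (q - p) mod n, the exponents -lk and (p - q)k agree modulo
    \<open>n\<close>, so the entry depends on \<open>l\<close> only.\<close>
  have entry: "entire_mat_fun f (map_mat complex_of_real (circulant n a)) $$ (p, q)
      = S (nat ((int q - int p) mod int n)) a / of_nat n" if "p < n" "q < n" for p q a
  proof -
    have "\<omega> powi (- (int (nat ((int q - int p) mod int n)) * int k))
        = \<omega> powi ((int p - int q) * int k)" for k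
      using powi_mod_mult[of "int q - int p" "- int k"] assms(1)
      by (simp add: algebra_simps)
    then show ?thesis
      by (simp only: S_def map_mat_circulant entire_mat_fun_circulant[OF assms(3) that])
  qed
  \<comment> \<open>Quantifying over circulant matrices amounts to quantifying over their generating
    sequences.\<close>
  have "preserves_nonneg_circulants n f \<longleftrightarrow> (\<forall>a. (\<forall>p<n. \<forall>q<n. circulant n a $$ (p, q) \<ge> 0) \<longrightarrow>
      (\<forall>p<n. \<forall>q<n. entire_mat_fun f (map_mat complex_of_real (circulant n a)) $$ (p, q) \<in> \<real>\<^sub>\<ge>\<^sub>0))"
    unfolding preserves_nonneg_circulants_def is_circulant_def by blast
  also have "\<dots> \<longleftrightarrow> (\<forall>a. (\<forall>j<n. a j \<ge> 0) \<longrightarrow>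
      (\<forall>p<n. \<forall>q<n. S (nat ((int q - int p) mod int n)) a \<in> \<real>\<^sub>\<ge>\<^sub>0))"
    by (simp add: circulant_nonneg_iff entry divide_of_nat_nonneg_Reals_iff[OF assms(1)] cong: imp_cong)
  also have "\<dots> \<longleftrightarrow> (\<forall>a. (\<forall>j<n. a j \<ge> 0) \<longrightarrow> (\<forall>l<n. S l a \<in> \<real>\<^sub>\<ge>\<^sub>0))"
  proof -
    have "(\<forall>p<n. \<forall>q<n. S (nat ((int q - int p) mod int n)) a \<in> \<real>\<^sub>\<ge>\<^sub>0)
        \<longleftrightarrow> (\<forall>l<n. S l a \<in> \<real>\<^sub>\<ge>\<^sub>0)" for a
    proof
      assume *: "\<forall>p<n. \<forall>q<n. S (nat ((int q - int p) mod int n)) a \<in> \<real>\<^sub>\<ge>\<^sub>0"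
      \<comment> \<open>Row 0 already attains every residue, as p = 0 and q = l give l
        itself.\<close>
      show "\<forall>l<n. S l a \<in> \<real>\<^sub>\<ge>\<^sub>0"
        using *[rule_format, of 0] by auto
    qed (auto simp: nat_less_iff)
    then show ?thesis by simp
  qed
  finally show ?thesis
    unfolding S_def eigval_def by blast
qed

end
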